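(* Let $G$ be a finite group and $H\le G$ a subgroup. Let $Q$ be a stochastic matrix with rows and columns indexed by $G/H$. The following are equivalent: (i) there is a weight $w$ on $G$ such that $\mathrm{MC}(\eta_G,w)$ lumps weakly to $G/H$ and the lumped chain has transition matrix $Q$; (ii) $Q$ is the transition matrix of the induced random walk on $G/H$ driven by a weight $w$ in $\eta_H\mathbb{C}[G]\eta_H$; (iii) $Q_{(gH,g'H)}=Q_{(kgH,kg'H)}$ for all $g,g',k\in G$; (iv) $Q$ is the transition matrix of the induced random walk on $G/H$ driven by a weight $w$ such that $w(gH)$ is constant for left cosets $gH$ in the same double coset of $H$, and $w(Hg)$ is constant for right cosets $Hg$ in the same double coset of $H$ (the conditions for $w$ to lump both strongly and exactly to $G/H$).
   Context: A weight on $G$ is a function $w:G\to\mathbb{R}_{\ge0}$, not identically zero (not required to have support generating $G$), identified with $\sum_gw(g)g\in\mathbb{C}[G]$; $w(K)=\sum_{g\in K}w(g)$ for $K\subseteq G$. $\eta_K=|K|^{-1}\sum_{g\in K}g$ for non-empty $K\subseteq G$. $\mathrm{MC}(\alpha,w)$ is the time-homogeneous Markov chain $(X_t)_{t\ge0}$ on $G$ with $X_0$ distributed as $\alpha$ and $\mathbb{P}[X_{t+1}=xg\mid X_t=x]=w(g)/w(G)$; it lumps weakly to $G/H$ if $(X_tH)_{t\ge0}$ is a time-homogeneous Markov chain on the set $G/H$ of left cosets, called the lumped chain. For weights as in (ii) and (iv), $\mathbb{P}[X_{t+1}\in g'H\mid X_t=x]$ depends on $x$ only through $xH$, and the transition matrix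 of the induced random walk on $G/H$ is the matrix with $(gH,g'H)$ entry $\mathbb{P}[X_{t+1}\in g'H\mid X_t=g]=w(g^{-1}g'H)/w(G)$. Double cosets are the sets $HxH$, $x\in G$. *)

theory Defs
  imports "HOL-Probability.Probability" "HOL-Algebra.Left_Coset"
begin

section \<open>Markov chains on a finite state space\<close>

definition stochastic_matrix :: "'s set \<Rightarrow> ('s \<Rightarrow> 's \<Rightarrow> real) \<Rightarrow> bool" where
  "stochastic_matrix S P \<longleftrightarrow>
     (\<forall>x\<in>S. \<forall>y\<in>S. 0 \<le> P x y) \<and> (\<forall>x\<in>S. (\<Sum>y\<in>S. P x y) = 1)"

text \<open>The process \<open>Y\<close> on the probability space \<open>M\<close> is a time-homogeneous Markov chain on \<open>S\<close> with
  transition matrix \<open>P\<close>. The condition is imposed on the histories of positive probability only,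
  since \<^const>\<open>cond_prob\<close> is \<open>0\<close> when the conditioning event is null.\<close>

definition markov_chain ::
  "'w measure \<Rightarrow> 's set \<Rightarrow> ('s \<Rightarrow> 's \<Rightarrow> real) \<Rightarrow> (nat \<Rightarrow> 'w \<Rightarrow> 's) \<Rightarrow> bool" where
  "markov_chain M S P Y \<longleftrightarrow>
     prob_space M \<and> (\<forall>t. Y t \<in> measurable M (count_space S)) \<and> stochastic_matrix S P \<and>
     (\<forall>t x. (\<forall>i\<le>Suc t. x i \<in> S) \<longrightarrow> \<P>(\<omega> in M. \<forall>i\<le>t. Y i \<omega> = x i) > 0 \<longrightarrow>
        \<P>(\<omega> in M. Y (Suc t) \<omega> = x (Suc t) \<bar> \<forall>i\<le>t. Y i \<omega> = x i) = P (x t) (x (Suc t)))"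


section \<open>Weights and the group algebra\<close>

text \<open>Functions on the group are represented by functions on the whole type. The values of a
  weight outside the carrier are irrelevant, and elements of the complex group algebra are
  normalised to be \<open>0\<close> there.\<close>

definition weight :: "('a, 'b) monoid_scheme \<Rightarrow> ('a \<Rightarrow> real) \<Rightarrow> bool" where
  "weight G w \<longleftrightarrow> (\<forall>g\<in>carrier G. 0 \<le> w g) \<and> (\<exists>g\<in>carrier G. w g \<noteq> 0)"

definition group_algebra :: "('a, 'b) monoid_scheme \<Rightarrow> ('a \<Rightarrow> complex) set" where
  "group_algebra G = {a. \<forall>g. g \<notin> carrier G \<longrightarrow> a g = 0}"

definition ga_mult ::
  "('a, 'b) monoid_scheme \<Rightarrow> ('a \<Rightarrow> complex) \<Rightarrow> ('a \<Rightarrow> complex) \<Rightarrow> 'a \<Rightarrow> complex" where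
  "ga_mult G a b =
     (\<lambda>g. if g \<in> carrier G
          then \<Sum>h\<in>carrier G. a h * b (inv\<^bsub>G\<^esub> h \<otimes>\<^bsub>G\<^esub> g) else 0)"

definition ga_of_weight :: "('a, 'b) monoid_scheme \<Rightarrow> ('a \<Rightarrow> real) \<Rightarrow> 'a \<Rightarrow> complex" where
  "ga_of_weight G w = (\<lambda>g. if g \<in> carrier G then complex_of_real (w g) else 0)"

text \<open>Used with complex values as an element of the group algebra, and with real values as the
  uniform distribution on \<open>K\<close>.\<close>

definition eta :: "'a set \<Rightarrow> 'a \<Rightarrow> 'c::field_char_0" where
  "eta K = (\<lambda>g. if g \<in> K then 1 / of_nat (card K) else 0)"

definition eta_sandwich :: "('a, 'b) monoid_scheme \<Rightarrow> 'a set \<Rightarrow> ('a \<Rightarrow> complex) set" where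
  "eta_sandwich G H = {ga_mult G (ga_mult G (eta H) a) (eta H) | a. a \<in> group_algebra G}"


section \<open>Random walks driven by a weight and their lumpings\<close>

text \<open>\<open>X\<close> is a realisation on \<open>M\<close> (a sufficiently rich space, e.g. a measure on
  \<open>nat \<Rightarrow> 'a\<close>) of the left-invariant walk with initial distribution \<open>\<alpha>\<close>:
  the step \<open>x \<mapsto> x \<otimes> g\<close> has probability \<open>w g / w(G)\<close>.\<close>

definition MC :: "('a, 'b) monoid_scheme \<Rightarrow> ('a \<Rightarrow> real) \<Rightarrow> ('a \<Rightarrow> real) \<Rightarrow>
    'w measure \<Rightarrow> (nat \<Rightarrow> 'w \<Rightarrow> 'a) \<Rightarrow> bool" where
  "MC G \<alpha> w M X \<longleftrightarrow>
     markov_chain M (carrier G) (\<lambda>x y. w (inv\<^bsub>G\<^esub> x \<otimes>\<^bsub>G\<^esub> y) / sum w (carrier G)) X \<and>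
     (\<forall>x\<in>carrier G. \<P>(\<omega> in M. X 0 \<omega> = x) = \<alpha> x)"

definition lumped :: "('a, 'b) monoid_scheme \<Rightarrow> 'a set \<Rightarrow>
    (nat \<Rightarrow> 'w \<Rightarrow> 'a) \<Rightarrow> nat \<Rightarrow> 'w \<Rightarrow> 'a set" where
  "lumped G H X = (\<lambda>t \<omega>. X t \<omega> <#\<^bsub>G\<^esub> H)"

definition lumps_weakly :: "('a, 'b) monoid_scheme \<Rightarrow> 'a set \<Rightarrow>
    'w measure \<Rightarrow> (nat \<Rightarrow> 'w \<Rightarrow> 'a) \<Rightarrow> bool" where
  "lumps_weakly G H M X \<longleftrightarrow> (\<exists>P. markov_chain M (lcosets\<^bsub>G\<^esub> H) P (lumped G H X))"

text \<open>Quantifying over all representatives \<open>g\<close>, \<open>g'\<close> includes the requirement that the right-hand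
  side depends on the cosets only; this is automatic for the weights considered here, see
  \<open>step_sum_well_defined\<close> and \<open>step_sum_well_defined_sandwich\<close>.\<close>

definition induced_walk_matrix :: "('a, 'b) monoid_scheme \<Rightarrow> 'a set \<Rightarrow>
    ('a \<Rightarrow> real) \<Rightarrow> ('a set \<Rightarrow> 'a set \<Rightarrow> real) \<Rightarrow> bool" where
  "induced_walk_matrix G H w Q \<longleftrightarrow>
     (\<forall>g\<in>carrier G. \<forall>g'\<in>carrier G.
        Q (g <#\<^bsub>G\<^esub> H) (g' <#\<^bsub>G\<^esub> H) =
          sum w ((inv\<^bsub>G\<^esub> g \<otimes>\<^bsub>G\<^esub> g') <#\<^bsub>G\<^esub> H) / sum w (carrier G))"

definition double_cosets :: "('a, 'b) monoid_scheme \<Rightarrow> 'a set \<Rightarrow> 'a set set" where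
  "double_cosets G H = {H <#>\<^bsub>G\<^esub> (x <#\<^bsub>G\<^esub> H) | x. x \<in> carrier G}"

definition constant_on_cosets_in_double_cosets ::
  "('a, 'b) monoid_scheme \<Rightarrow> 'a set \<Rightarrow> 'a set set \<Rightarrow> ('a \<Rightarrow> real) \<Rightarrow> bool" where
  "constant_on_cosets_in_double_cosets G H \<C> w \<longleftrightarrow>
     (\<forall>D\<in>double_cosets G H. \<forall>C\<in>\<C>. \<forall>C'\<in>\<C>. C \<subseteq> D \<longrightarrow> C' \<subseteq> D \<longrightarrow> sum w C = sum w C')"

context group
begin

lemma step_sum_well_defined:
  assumes H: "subgroup H G"
    and w: "constant_on_cosets_in_double_cosets G H (lcosets H) w"
    and g: "g1 \<in> carrier G" "g2 \<in> carrier G" "g1' \<in> carrier G" "g2' \<in> carrier G"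
    and eq: "g1 <# H = g2 <# H" "g1' <# H = g2' <# H"
  shows "sum w ((inv g1 \<otimes> g1') <# H) = sum w ((inv g2 \<otimes> g2') <# H)"
proof -
  have HG: "H \<subseteq> carrier G" using H by (rule subgroup.subset)
  obtain h where h: "h \<in> H" "g2 = g1 \<otimes> h"
    using lcos_self[OF g(2) H] eq(1) unfolding l_coset_def by auto
  have hG: "h \<in> carrier G" using h(1) HG by blast
  let ?x = "inv g1 \<otimes> g1'" and ?y = "inv g2 \<otimes> g2'"
  have x: "?x \<in> carrier G" and y: "?y \<in> carrier G" using g by auto
  have "?y <# H = inv g2 <# (g2' <# H)" using g HG by (simp add: lcos_m_assoc)
  also have "\<dots> = inv g2 <# (g1' <# H)" using eq(2) by simp
  also have "\<dots> = (inv h \<otimes> ?x) <# H"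
    using g hG HG h(2) by (simp add: lcos_m_assoc inv_mult_group m_assoc)
  finally have yc: "?y <# H = (inv h \<otimes> ?x) <# H" .
  let ?D = "H <#> (?x <# H)"
  have "?x <# H \<subseteq> ?D"
  proof
    fix z assume z: "z \<in> ?x <# H"
    then have "z = \<one> \<otimes> z" using l_coset_subset_G[OF HG x] by auto
    then show "z \<in> ?D" using z subgroup.one_closed[OF H] unfolding set_mult_def by blast
  qed
  moreover have "?y <# H \<subseteq> ?D"
  proof
    fix z assume "z \<in> ?y <# H"
    then have "z \<in> inv h <# (?x <# H)" using yc x hG HG by (simp add: lcos_m_assoc)
    then show "z \<in> ?D" using subgroup.m_inv_closed[OF H h(1)]
      unfolding set_mult_def l_coset_def by blast
  qed
  moreover have "?D \<in> double_cosets G H" using x by (auto simp: double_cosets_def)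
  moreover have "?x <# H \<in> lcosets H" "?y <# H \<in> lcosets H"
    using x y by (auto simp: LCOSETS_def)
  ultimately show ?thesis
    using w unfolding constant_on_cosets_in_double_cosets_def by blast
qed

lemma eta_mult_left_invariant:
  assumes H: "subgroup H G" and h: "h \<in> H" and g: "g \<in> carrier G" and fin: "finite (carrier G)"
  shows "ga_mult G (eta H) b (h \<otimes> g) = ga_mult G (eta H) b g"
proof -
  have HG: "H \<subseteq> carrier G" using H by (rule subgroup.subset)
  have hG: "h \<in> carrier G" using h HG by blast
  have red: "ga_mult G (eta H) b x = (\<Sum>k\<in>H. 1 / of_nat (card H) * b (inv k \<otimes> x))"
    if "x \<in> carrier G" for x
  proof -
    have "(\<Sum>k\<in>carrier G. eta H k * b (inv k \<otimes> x)) = (\<Sum>k\<in>H. eta H k * b (inv k \<otimes> x))"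
      by (rule sum.mono_neutral_right) (use fin HG in \<open>auto simp: eta_def\<close>)
    then show ?thesis using that by (simp add: ga_mult_def eta_def)
  qed
  have "(\<Sum>k\<in>H. 1 / of_nat (card H) * b (inv k \<otimes> (h \<otimes> g))) =
        (\<Sum>k\<in>H. 1 / of_nat (card H) * b (inv k \<otimes> g))"
  proof (rule sum.reindex_bij_witness[where i = "\<lambda>k. h \<otimes> k" and j = "\<lambda>k. inv h \<otimes> k"])
    fix k assume k: "k \<in> H"
    then have kG: "k \<in> carrier G" using HG by blast
    show "h \<otimes> (inv h \<otimes> k) = k" "inv h \<otimes> (h \<otimes> k) = k"
      using hG kG by (simp_all add: m_assoc[symmetric])
    show "inv h \<otimes> k \<in> H" "h \<otimes> k \<in> H"
      using H h k by (simp_all add: subgroup.m_closed subgroup.m_inv_closed)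
    show "1 / of_nat (card H) * b (inv (inv h \<otimes> k) \<otimes> g) =
          1 / of_nat (card H) * b (inv k \<otimes> (h \<otimes> g))"
      using hG kG g by (simp add: inv_mult_group m_assoc)
  qed
  then show ?thesis using red g hG by simp
qed

lemma inv_cancel:
  assumes "h \<in> carrier G" "x \<in> carrier G"
  shows "h \<otimes> (inv h \<otimes> x) = x" "inv h \<otimes> (h \<otimes> x) = x"
  using assms by (simp_all add: m_assoc[symmetric])

lemma ga_mult_assoc:
  assumes fin: "finite (carrier G)"
  shows "ga_mult G (ga_mult G a b) c = ga_mult G a (ga_mult G b c)"
proof
  fix g
  show "ga_mult G (ga_mult G a b) c g = ga_mult G a (ga_mult G b c) g"
  proof (cases "g \<in> carrier G")
    case True
    have "ga_mult G (ga_mult G a b) c g =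
        (\<Sum>x\<in>carrier G. \<Sum>h\<in>carrier G. a h * b (inv h \<otimes> x) * c (inv x \<otimes> g))"
      using True by (simp add: ga_mult_def sum_distrib_right)
    also have "\<dots> = (\<Sum>h\<in>carrier G. \<Sum>x\<in>carrier G. a h * b (inv h \<otimes> x) * c (inv x \<otimes> g))"
      by (rule sum.swap)
    also have "\<dots> = (\<Sum>h\<in>carrier G. \<Sum>y\<in>carrier G. a h * b y * c (inv y \<otimes> (inv h \<otimes> g)))"
    proof (rule sum.cong[OF refl])
      fix h assume h: "h \<in> carrier G"
      show "(\<Sum>x\<in>carrier G. a h * b (inv h \<otimes> x) * c (inv x \<otimes> g)) =
            (\<Sum>y\<in>carrier G. a h * b y * c (inv y \<otimes> (inv h \<otimes> g)))"
        by (rule sum.reindex_bij_witness[where i = "\<lambda>y. h \<otimes> y" and j = "\<lambda>x. inv h \<otimes> x"])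
          (use h True in \<open>auto simp: inv_mult_group m_assoc inv_cancel\<close>)
    qed
    also have "\<dots> = ga_mult G a (ga_mult G b c) g"
      using True by (simp add: ga_mult_def sum_distrib_left mult.assoc)
    finally show ?thesis .
  qed (simp add: ga_mult_def)
qed

lemma step_sum_well_defined_sandwich:
  assumes H: "subgroup H G" and fin: "finite (carrier G)"
    and w: "ga_of_weight G w \<in> eta_sandwich G H"
    and g: "g1 \<in> carrier G" "g2 \<in> carrier G" "g1' \<in> carrier G" "g2' \<in> carrier G"
    and eq: "g1 <# H = g2 <# H" "g1' <# H = g2' <# H"
  shows "sum w ((inv g1 \<otimes> g1') <# H) = sum w ((inv g2 \<otimes> g2') <# H)"
proof -
  have HG: "H \<subseteq> carrier G" using H by (rule subgroup.subset)
  obtain b where b: "ga_of_weight G w = ga_mult G (eta H) b"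
    using w by (auto simp: eta_sandwich_def ga_mult_assoc[OF fin])
  have inv: "w (h \<otimes> x) = w x" if "h \<in> H" "x \<in> carrier G" for h x
  proof -
    have "h \<otimes> x \<in> carrier G" using that HG by blast
    then show ?thesis
      using eta_mult_left_invariant[OF H that fin, of b] that(2)
      unfolding b[symmetric] by (simp add: ga_of_weight_def)
  qed
  obtain h where h: "h \<in> H" "g2 = g1 \<otimes> h"
    using lcos_self[OF g(2) H] eq(1) unfolding l_coset_def by auto
  have hG: "h \<in> carrier G" using h(1) HG by blast
  let ?x = "inv g1 \<otimes> g1'"
  have x: "?x \<in> carrier G" using g by auto
  have xH: "?x <# H \<subseteq> carrier G" using l_coset_subset_G[OF HG x] .
  have "(inv g2 \<otimes> g2') <# H = inv g2 <# (g2' <# H)" using g HG by (simp add: lcos_m_assoc)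
  also have "\<dots> = inv g2 <# (g1' <# H)" using eq(2) by simp
  also have "\<dots> = inv h <# (?x <# H)"
    using g hG HG h(2) by (simp add: lcos_m_assoc inv_mult_group m_assoc)
  also have "\<dots> = (\<lambda>z. inv h \<otimes> z) ` (?x <# H)" by (auto simp: l_coset_def)
  finally have "sum w ((inv g2 \<otimes> g2') <# H) = sum w ((\<lambda>z. inv h \<otimes> z) ` (?x <# H))"
    by simp
  also have "\<dots> = (\<Sum>z\<in>?x <# H. w (inv h \<otimes> z))"
    by (rule sum.reindex[unfolded comp_def]) (use xH hG in \<open>meson inj_on_subset inj_on_cmult inv_closed\<close>)
  also have "\<dots> = sum w (?x <# H)"
    using inv[OF subgroup.m_inv_closed[OF H h(1)]] xH by (intro sum.cong) auto
  finally show ?thesis by simp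
qed

end

end

theory Submission
  imports Defs
begin

text \<open>
  Everything turns on the invariance (iii), \<open>Q (gH) (g'H) = Q (kgH) (kg'H)\<close>.

  Any matrix of an induced walk has it, because \<open>(kg)\<inverse>(kg') = g\<inverse>g'\<close>; this settles
  (ii) \<open>\<Longrightarrow>\<close> (iii) and (iv) \<open>\<Longrightarrow>\<close> (iii). For (i) \<open>\<Longrightarrow>\<close> (iii) no information on \<open>w\<close> is at hand,
  and the invariance comes from the uniform start: every coset has probability \<open>|H| / |G| > 0\<close> at
  time \<open>0\<close>, so that the lumped transition matrix is determined by the joint law of \<open>X\<^sub>0\<close> and \<open>X\<^sub>1\<close>,
  and that law is invariant under left translation
  (\<open>uniform_walk_lumped_matrix_translation_invariant\<close>).

  Conversely, a matrix with (iii) is determined by its row at the coset \<open>H\<close>. Spreading this row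
  evenly over the cosets gives the weight \<open>w g = Q H (gH) / |H|\<close>, and (iii) with \<open>k \<in> H\<close> says
  that \<open>w\<close> is constant on double cosets (\<open>coset_row_weight\<close>). Such a weight is fixed by
  multiplication with \<open>\<eta>\<^sub>H\<close> on either side and has equal sums over equally large subsets of a double
  coset, whence (ii) and (iv). For (i), the walk is realised on a space of independent increments;
  since the probability of stepping from \<open>x\<close> into \<open>g'H\<close> is \<open>Q (xH) (g'H)\<close> for every \<open>x\<close>, the image
  process is Markov for every starting distribution, by summing over all paths above a given path
  of cosets (\<open>markov_chain_strong_lumping\<close>).
\<close>

text \<open>The multiset inclusion shares its symbol with left cosets, which makes sums over cosets
  ambiguous.\<close>

no_notation subset_mset (infix \<open><#\<close> 50)

section \<open>Markov chains and strong lumping\<close>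

lemma (in prob_space) prob_partition:
  assumes T: "finite T"
    and sets: "\<And>z. z \<in> T \<Longrightarrow> {\<omega> \<in> space M. E \<omega> \<and> Z \<omega> = z} \<in> events"
    and Z: "\<And>\<omega>. \<omega> \<in> space M \<Longrightarrow> E \<omega> \<Longrightarrow> Z \<omega> \<in> T"
  shows "\<P>(\<omega> in M. E \<omega>) = (\<Sum>z\<in>T. \<P>(\<omega> in M. E \<omega> \<and> Z \<omega> = z))"
proof -
  have "{\<omega> \<in> space M. E \<omega>} = (\<Union>z\<in>T. {\<omega> \<in> space M. E \<omega> \<and> Z \<omega> = z})"
    using Z by auto
  then show ?thesis
    using finite_measure_finite_Union[OF T, of "\<lambda>z. {\<omega> \<in> space M. E \<omega> \<and> Z \<omega> = z}"] sets
    by (auto simp: disjoint_family_on_def)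
qed

lemma markov_chain_event:
  assumes "markov_chain M S P X" and "s \<in> S"
  shows "{\<omega> \<in> space M. X t \<omega> = s} \<in> sets M"
proof -
  have "X t -` {s} \<inter> space M \<in> sets M"
    using assms by (intro measurable_sets[of _ _ "count_space S"]) (auto simp: markov_chain_def)
  then show ?thesis by (simp add: vimage_def Int_def conj_commute)
qed

lemma markov_chain_path_event:
  assumes "markov_chain M S P X" and "\<And>i. i \<le> t \<Longrightarrow> x i \<in> S"
  shows "{\<omega> \<in> space M. \<forall>i\<le>t. X i \<omega> = x i} \<in> sets M"
proof -
  have "{\<omega> \<in> space M. \<forall>i\<in>{..t}. X i \<omega> = x i} \<in> sets M"
    using assms(2)
    by (intro sets.sets_Collect_finite_All markov_chain_event[OF assms(1)]) simp_all
  then show ?thesis by (simp only: Ball_def atMost_iff)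
qed

text \<open>The product form of the Markov property also holds for histories of probability zero,
  where both sides vanish; this is what makes it possible to sum over histories.\<close>

lemma markov_chain_step:
  assumes X: "markov_chain M S P X" and x: "\<And>i. i \<le> t \<Longrightarrow> x i \<in> S" and y: "y \<in> S"
  shows "\<P>(\<omega> in M. (\<forall>i\<le>t. X i \<omega> = x i) \<and> X (Suc t) \<omega> = y) =
    \<P>(\<omega> in M. \<forall>i\<le>t. X i \<omega> = x i) * P (x t) y"
proof -
  interpret prob_space M using X by (simp add: markov_chain_def)
  let ?H = "{\<omega> \<in> space M. \<forall>i\<le>t. X i \<omega> = x i}"
  let ?J = "{\<omega> \<in> space M. (\<forall>i\<le>t. X i \<omega> = x i) \<and> X (Suc t) \<omega> = y}"
  show ?thesis
  proof (cases "prob ?H > 0")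
    case True
    let ?x = "x(Suc t := y)"
    have S: "\<forall>i\<le>Suc t. ?x i \<in> S" using x y by auto
    have hist: "(\<forall>i\<le>t. X i \<omega> = ?x i) \<longleftrightarrow> (\<forall>i\<le>t. X i \<omega> = x i)" for \<omega> by auto
    have markov: "\<P>(\<omega> in M. \<forall>i\<le>t. X i \<omega> = z i) > 0 \<longrightarrow>
        \<P>(\<omega> in M. X (Suc t) \<omega> = z (Suc t) \<bar> \<forall>i\<le>t. X i \<omega> = z i) = P (z t) (z (Suc t))"
      if "\<forall>i\<le>Suc t. z i \<in> S" for z
      using X that unfolding markov_chain_def by blast
    have "\<P>(\<omega> in M. X (Suc t) \<omega> = y \<bar> \<forall>i\<le>t. X i \<omega> = x i) = P (x t) y"
      using markov[OF S] True unfolding hist by simp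
    then have "\<P>(\<omega> in M. X (Suc t) \<omega> = y \<and> (\<forall>i\<le>t. X i \<omega> = x i)) = P (x t) y * prob ?H"
      using True by (simp add: cond_prob_def field_simps)
    then show ?thesis by (simp add: conj_commute mult.commute)
  next
    case False
    then have "prob ?H = 0" by (simp add: zero_less_measure_iff)
    moreover have "prob ?J \<le> prob ?H"
      by (intro finite_measure_mono markov_chain_path_event[OF X] x) auto
    ultimately show ?thesis by (simp add: measure_le_0_iff)
  qed
qed

text \<open>Kemeny and Snell's condition for strong lumpability: when the probability of stepping into a
  fibre of \<open>f\<close> depends on the fibre of the present state only, the factor \<open>Q (c t) (c (Suc t))\<close> is
  common to all paths that lie above a path \<open>c\<close> of fibres and can be taken out of the sum.\<close>

lemma markov_chain_strong_lumping:
  fixes S :: "'s set" and S' :: "'r set" and f :: "'s \<Rightarrow> 'r"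
  assumes X: "markov_chain M S P X" and S: "finite S" and f: "f \<in> S \<rightarrow> S'"
    and Q: "stochastic_matrix S' Q"
    and lump: "\<And>x c. x \<in> S \<Longrightarrow> c \<in> S' \<Longrightarrow> (\<Sum>y | y \<in> S \<and> f y = c. P x y) = Q (f x) c"
  shows "markov_chain M S' Q (\<lambda>t \<omega>. f (X t \<omega>))"
proof -
  interpret prob_space M using X by (simp add: markov_chain_def)
  have meas: "X t \<in> measurable M (count_space S)" for t
    using X by (simp add: markov_chain_def)
  have XS: "X t \<omega> \<in> S" if "\<omega> \<in> space M" for t \<omega>
    using measurable_space[OF meas that] by simp
  define F where "F c = {y \<in> S. f y = c}" for c
  have F: "finite (F c)" for c using S by (simp add: F_def)
  have step: "\<P>(\<omega> in M. f (X (Suc t) \<omega>) = c (Suc t) \<and> (\<forall>i\<le>t. f (X i \<omega>) = c i)) =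
      \<P>(\<omega> in M. \<forall>i\<le>t. f (X i \<omega>) = c i) * Q (c t) (c (Suc t))"
    if c: "\<forall>i\<le>Suc t. c i \<in> S'" for t c
  proof -
    define T where "T = PiE {..t} (\<lambda>i. F (c i))"
    have T: "finite T" unfolding T_def by (intro finite_PiE) (auto simp: F)
    have xS: "x i \<in> S" "f (x i) = c i" if "x \<in> T" "i \<le> t" for x i
      using that by (auto simp: T_def F_def)
    \<comment> \<open>The whole history as one random variable, with finitely many values above \<open>c\<close>.\<close>
    define past where "past \<omega> = restrict (\<lambda>i. X i \<omega>) {..t}" for \<omega>
    have past_eq: "past \<omega> = x \<longleftrightarrow> (\<forall>i\<le>t. X i \<omega> = x i)" if "x \<in> T" for x \<omega>
      using that by (fastforce simp: past_def T_def PiE_def extensional_def restrict_def fun_eq_iff)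
    have past_T: "past \<omega> \<in> T" if "\<omega> \<in> space M" "\<forall>i\<le>t. f (X i \<omega>) = c i" for \<omega>
      using that XS by (auto simp: past_def T_def F_def)
    have hist: "(\<forall>i\<le>t. f (X i \<omega>) = c i) \<and> past \<omega> = x \<longleftrightarrow> (\<forall>i\<le>t. X i \<omega> = x i)"
      if "x \<in> T" for x \<omega>
      using past_eq[OF that] xS(2)[OF that] by metis
    have "\<P>(\<omega> in M. \<forall>i\<le>t. f (X i \<omega>) = c i) =
        (\<Sum>x\<in>T. \<P>(\<omega> in M. (\<forall>i\<le>t. f (X i \<omega>) = c i) \<and> past \<omega> = x))"
    proof (rule prob_partition[OF T])
      fix x assume "x \<in> T"
      then show "{\<omega> \<in> space M. (\<forall>i\<le>t. f (X i \<omega>) = c i) \<and> past \<omega> = x} \<in> events"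
        unfolding hist[OF \<open>x \<in> T\<close>] by (intro markov_chain_path_event[OF X] xS(1))
    qed (use past_T in auto)
    then have history: "\<P>(\<omega> in M. \<forall>i\<le>t. f (X i \<omega>) = c i) =
        (\<Sum>x\<in>T. \<P>(\<omega> in M. \<forall>i\<le>t. X i \<omega> = x i))"
      by (simp add: hist)
    let ?E = "\<lambda>\<omega>. f (X (Suc t) \<omega>) = c (Suc t) \<and> (\<forall>i\<le>t. f (X i \<omega>) = c i)"
    let ?Z = "\<lambda>\<omega>. (past \<omega>, X (Suc t) \<omega>)"
    have E_eq: "?E \<omega> \<and> ?Z \<omega> = (x, y) \<longleftrightarrow> (\<forall>i\<le>t. X i \<omega> = x i) \<and> X (Suc t) \<omega> = y"
      if "x \<in> T" "y \<in> F (c (Suc t))" for x y \<omega>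
      using hist[OF that(1), of \<omega>] that(2) by (auto simp: F_def)
    have "\<P>(\<omega> in M. ?E \<omega>) =
        (\<Sum>z\<in>T \<times> F (c (Suc t)). \<P>(\<omega> in M. ?E \<omega> \<and> ?Z \<omega> = z))"
    proof (rule prob_partition)
      fix z assume "z \<in> T \<times> F (c (Suc t))"
      then obtain x y where z: "z = (x, y)" "x \<in> T" "y \<in> F (c (Suc t))" by auto
      have "{\<omega> \<in> space M. (\<forall>i\<le>t. X i \<omega> = x i) \<and> X (Suc t) \<omega> = y} \<in> events"
        using z xS(1) by (intro sets.sets_Collect_conj markov_chain_path_event[OF X]
          markov_chain_event[OF X]) (auto simp: F_def)
      then show "{\<omega> \<in> space M. ?E \<omega> \<and> ?Z \<omega> = z} \<in> events"
        unfolding z(1) E_eq[OF z(2,3)] .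
    qed (use T F past_T XS in \<open>auto simp: F_def\<close>)
    also have "\<dots> = (\<Sum>x\<in>T. \<Sum>y\<in>F (c (Suc t)). \<P>(\<omega> in M. ?E \<omega> \<and> ?Z \<omega> = (x, y)))"
      by (simp only: sum.cartesian_product split_def prod.collapse)
    also have "\<dots> = (\<Sum>x\<in>T. \<Sum>y\<in>F (c (Suc t)).
        \<P>(\<omega> in M. \<forall>i\<le>t. X i \<omega> = x i) * P (x t) y)"
    proof (intro sum.cong refl)
      fix x y assume xy: "x \<in> T" "y \<in> F (c (Suc t))"
      show "\<P>(\<omega> in M. ?E \<omega> \<and> ?Z \<omega> = (x, y)) =
          \<P>(\<omega> in M. \<forall>i\<le>t. X i \<omega> = x i) * P (x t) y"
        unfolding E_eq[OF xy] using xy xS(1)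
        by (intro markov_chain_step[OF X]) (auto simp: F_def)
    qed
    also have "\<dots> = (\<Sum>x\<in>T. \<P>(\<omega> in M. \<forall>i\<le>t. X i \<omega> = x i) * Q (c t) (c (Suc t)))"
    proof (intro sum.cong refl)
      fix x assume x: "x \<in> T"
      have "(\<Sum>y\<in>F (c (Suc t)). P (x t) y) = Q (c t) (c (Suc t))"
        using lump[of "x t" "c (Suc t)"] xS[OF x] c by (simp add: F_def)
      then show "(\<Sum>y\<in>F (c (Suc t)). \<P>(\<omega> in M. \<forall>i\<le>t. X i \<omega> = x i) * P (x t) y) =
          \<P>(\<omega> in M. \<forall>i\<le>t. X i \<omega> = x i) * Q (c t) (c (Suc t))"
        by (simp add: sum_distrib_left[symmetric])
    qed
    finally show ?thesis unfolding history by (simp add: sum_distrib_right)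
  qed
  have "(\<lambda>\<omega>. f (X t \<omega>)) \<in> measurable M (count_space S')" for t
    using f by (intro measurable_compose[OF meas]) auto
  then show ?thesis
    unfolding markov_chain_def cond_prob_def using Q step
    by (auto simp: prob_space_axioms)
qed

section \<open>Random walks on a finite group\<close>

context group
begin

lemma sum_left_translate:
  assumes "x \<in> carrier G"
  shows "(\<Sum>y\<in>carrier G. f (inv x \<otimes> y)) = (\<Sum>y\<in>carrier G. f y)"
  by (rule sum.reindex_bij_witness[where i = "\<lambda>y. x \<otimes> y" and j = "\<lambda>y. inv x \<otimes> y"])
    (use assms in \<open>auto simp: inv_cancel\<close>)

lemma weight_total_pos:
  assumes "finite (carrier G)" and "weight G w"
  shows "sum w (carrier G) > 0"
proof -
  obtain g where "g \<in> carrier G" "w g > 0"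
    using assms(2) by (auto simp: weight_def less_le)
  then show ?thesis
    using assms by (intro sum_pos2[of _ g]) (auto simp: weight_def)
qed

lemma walk_matrix_stochastic:
  assumes fin: "finite (carrier G)" and w: "weight G w"
  shows "stochastic_matrix (carrier G) (\<lambda>x y. w (inv x \<otimes> y) / sum w (carrier G))"
  using w weight_total_pos[OF fin w] sum_left_translate[of _ w]
  by (auto simp: stochastic_matrix_def weight_def sum_divide_distrib[symmetric])

primrec partial_product :: "nat \<Rightarrow> (nat \<Rightarrow> 'a) \<Rightarrow> 'a" where
  "partial_product 0 \<omega> = \<omega> 0"
| "partial_product (Suc t) \<omega> = partial_product t \<omega> \<otimes> \<omega> (Suc t)"

primrec increment :: "(nat \<Rightarrow> 'a) \<Rightarrow> nat \<Rightarrow> 'a" where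
  "increment x 0 = x 0"
| "increment x (Suc t) = inv (x t) \<otimes> x (Suc t)"

lemma partial_product_closed:
  "(\<And>i. i \<le> t \<Longrightarrow> \<omega> i \<in> carrier G) \<Longrightarrow> partial_product t \<omega> \<in> carrier G"
  by (induction t) auto

lemma increment_closed:
  assumes "\<And>j. j \<le> i \<Longrightarrow> x j \<in> carrier G"
  shows "increment x i \<in> carrier G"
  using assms by (cases i) auto

lemma partial_product_path_iff:
  assumes \<omega>: "\<And>i. \<omega> i \<in> carrier G" and x: "\<And>i. i \<le> t \<Longrightarrow> x i \<in> carrier G"
  shows "(\<forall>i\<le>t. partial_product i \<omega> = x i) \<longleftrightarrow> (\<forall>i\<le>t. \<omega> i = increment x i)"
  using x
proof (induction t)
  case (Suc t)
  have "partial_product (Suc t) \<omega> = x (Suc t) \<longleftrightarrow> \<omega> (Suc t) = increment x (Suc t)"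
    if "partial_product t \<omega> = x t"
    using that \<omega> Suc.prems[of t] Suc.prems[of "Suc t"]
    by (metis increment.simps(2) inv_cancel le_refl le_SucI partial_product.simps(2))
  then show ?case using Suc by (auto simp: le_Suc_eq)
qed simp

text \<open>The walk with initial distribution \<open>\<alpha>\<close> exists: take the partial products of independent
  increments, the first one with distribution \<open>\<alpha>\<close> and the others with distribution \<open>w / w(G)\<close>. A
  path of the walk then corresponds to a sequence of increments, so its probability is a product.\<close>

lemma MC_exists:
  assumes fin: "finite (carrier G)" and w: "weight G w"
    and \<alpha>: "\<And>x. x \<in> carrier G \<Longrightarrow> 0 \<le> \<alpha> x" "sum \<alpha> (carrier G) = 1"
  shows "\<exists>(M :: (nat \<Rightarrow> 'a) measure) X. MC G \<alpha> w M X"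
proof -
  define p where "p = (\<lambda>g. w g / sum w (carrier G))"
  define q where "q i = (if i = 0 then \<alpha> else p)" for i :: nat
  have W: "sum w (carrier G) > 0" by (rule weight_total_pos[OF fin w])
  have q: "0 \<le> q i g" if "g \<in> carrier G" for i g
    using that \<alpha> w W by (auto simp: q_def p_def weight_def)
  have q1: "sum (q i) (carrier G) = 1" for i
    using \<alpha> W by (auto simp: q_def p_def sum_divide_distrib[symmetric])
  let ?N = "\<lambda>i. point_measure (carrier G) (q i)"
  have N: "prob_space (?N i)" for i
    using fin q q1[of i]
    by (intro prob_spaceI) (simp add: space_point_measure emeasure_point_measure_finite sum_ennreal)
  interpret P: product_prob_space ?N UNIV
    using N by (auto simp: product_prob_space_def product_prob_space_axioms_def
        product_sigma_finite_def intro: prob_space_imp_sigma_finite)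
  let ?M = "PiM UNIV ?N"
  have M_carrier: "\<omega> i \<in> carrier G" if "\<omega> \<in> space ?M" for \<omega> i
    using that by (auto simp: space_PiM space_point_measure)
  have path: "\<P>(\<omega> in ?M. \<forall>i\<le>t. partial_product i \<omega> = x i) = (\<Prod>i\<le>t. q i (increment x i))"
    if x: "\<And>i. i \<le> t \<Longrightarrow> x i \<in> carrier G" for t x
  proof -
    have inc: "increment x i \<in> carrier G" if "i \<le> t" for i
      using x that by (intro increment_closed) auto
    have "{\<omega> \<in> space ?M. \<forall>i\<le>t. partial_product i \<omega> = x i} =
        {\<omega> \<in> space ?M. \<forall>i\<in>{..t}. \<omega> i \<in> {increment x i}}"
      using partial_product_path_iff[of _ t x] x M_carrier by (intro Collect_cong) blast
    then have "emeasure ?M {\<omega> \<in> space ?M. \<forall>i\<le>t. partial_product i \<omega> = x i} =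
        (\<Prod>i\<in>{..t}. emeasure (?N i) {increment x i})"
      using inc
      by (subst P.emeasure_PiM_Collect[symmetric]) (auto simp: sets_point_measure)
    also have "\<dots> = (\<Prod>i\<in>{..t}. ennreal (q i (increment x i)))"
      using inc fin by (intro prod.cong) (auto simp: emeasure_point_measure_finite)
    also have "\<dots> = ennreal (\<Prod>i\<le>t. q i (increment x i))"
      using inc q by (intro prod_ennreal) auto
    finally show ?thesis
      using prod_nonneg[of "{..t}" "\<lambda>i. q i (increment x i)"] inc q
      by (simp add: measure_def)
  qed
  have step: "\<P>(\<omega> in ?M. partial_product (Suc t) \<omega> = x (Suc t) \<bar>
        \<forall>i\<le>t. partial_product i \<omega> = x i) = p (inv (x t) \<otimes> x (Suc t))"
    if x: "\<forall>i\<le>Suc t. x i \<in> carrier G"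
      and pos: "\<P>(\<omega> in ?M. \<forall>i\<le>t. partial_product i \<omega> = x i) > 0" for t x
  proof -
    have "\<P>(\<omega> in ?M. partial_product (Suc t) \<omega> = x (Suc t) \<and> (\<forall>i\<le>t. partial_product i \<omega> = x i))
        = \<P>(\<omega> in ?M. \<forall>i\<le>Suc t. partial_product i \<omega> = x i)"
      by (rule arg_cong[where f = "measure ?M"]) (auto simp: le_Suc_eq)
    also have "\<dots> = \<P>(\<omega> in ?M. \<forall>i\<le>t. partial_product i \<omega> = x i) * q (Suc t) (increment x (Suc t))"
      using x by (simp add: path atMost_Suc del: increment.simps)
    finally show ?thesis using pos by (simp add: cond_prob_def q_def)
  qed
  have "partial_product t \<in> measurable ?M (count_space (carrier G))" for t
  proof (induction t)
    case 0
    have "(\<lambda>\<omega>. \<omega> 0) \<in> measurable ?M (?N 0)" by simp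
    then show ?case by (simp add: measurable_cong_sets[OF refl sets_point_measure_count_space])
  next
    case (Suc t)
    have coord: "(\<lambda>\<omega>. \<omega> (Suc t)) \<in> measurable ?M (count_space (carrier G))"
      using measurable_component_singleton[of "Suc t" UNIV ?N]
      by (simp add: measurable_cong_sets[OF refl sets_point_measure_count_space])
    have "(\<lambda>\<omega>. partial_product t \<omega> \<otimes> \<omega> (Suc t)) \<in> measurable ?M (count_space (carrier G))"
      by (rule measurable_compose_countable'[OF _ Suc, where f = "\<lambda>g \<omega>. g \<otimes> \<omega> (Suc t)"])
        (use fin in \<open>auto intro!: measurable_compose[OF coord] countable_finite\<close>)
    then show ?case by simp
  qed
  then have "markov_chain ?M (carrier G) (\<lambda>x y. p (inv x \<otimes> y)) partial_product"
    unfolding markov_chain_def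
    using step walk_matrix_stochastic[OF fin w] P.prob_space_axioms by (simp add: p_def)
  moreover have "\<P>(\<omega> in ?M. partial_product 0 \<omega> = x) = \<alpha> x" if "x \<in> carrier G" for x
    using path[of 0 "\<lambda>_. x"] that by (simp add: q_def)
  ultimately have "MC G \<alpha> w ?M partial_product"
    by (simp add: MC_def p_def)
  then show ?thesis by blast
qed

section \<open>Left cosets and the induced walk\<close>

lemma l_coset_sum:
  assumes "H \<subseteq> carrier G" and "x \<in> carrier G"
  shows "sum f (x <# H) = (\<Sum>h\<in>H. f (x \<otimes> h))"
proof -
  have "x <# H = (\<lambda>h. x \<otimes> h) ` H" by (auto simp: l_coset_def)
  moreover have "inj_on (\<lambda>h. x \<otimes> h) H"
    using assms by (meson inj_on_cmult inj_on_subset)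
  ultimately show ?thesis by (simp add: sum.reindex)
qed

lemma l_coset_fibre:
  assumes H: "subgroup H G" and g: "g \<in> carrier G"
  shows "{y \<in> carrier G. y <# H = g <# H} = g <# H"
proof (intro equalityI subsetI)
  fix y assume "y \<in> {y \<in> carrier G. y <# H = g <# H}"
  then show "y \<in> g <# H" using lcos_self[OF _ H, of y] by auto
next
  fix y assume "y \<in> g <# H"
  then show "y \<in> {y \<in> carrier G. y <# H = g <# H}"
    using l_repr_independence[OF _ g H, of y] l_coset_carrier[OF _ g H, of y] by simp
qed

lemma l_coset_in_lcosets: "g \<in> carrier G \<Longrightarrow> g <# H \<in> lcosets H"
  by (auto simp: LCOSETS_def)

lemma induced_walk_matrix_translation_invariant:
  assumes Q: "induced_walk_matrix G H w Q"
    and g: "g \<in> carrier G" "g' \<in> carrier G" and k: "k \<in> carrier G"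
  shows "Q ((k \<otimes> g) <# H) ((k \<otimes> g') <# H) = Q (g <# H) (g' <# H)"
proof -
  have "inv (k \<otimes> g) \<otimes> (k \<otimes> g') = inv g \<otimes> g'"
    using g k by (simp add: inv_mult_group m_assoc inv_cancel)
  moreover note Q[unfolded induced_walk_matrix_def, rule_format, OF g]
  moreover have "Q ((k \<otimes> g) <# H) ((k \<otimes> g') <# H) =
      sum w ((inv (k \<otimes> g) \<otimes> (k \<otimes> g')) <# H) / sum w (carrier G)"
    using g k by (intro Q[unfolded induced_walk_matrix_def, rule_format]) auto
  ultimately show ?thesis by (simp only:)
qed

text \<open>An induced walk matrix records the probability of stepping from \<open>x\<close> into a coset for every
  \<open>x\<close>, which is exactly what strong lumping asks for.\<close>

lemma lumped_walk_markov_chain: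
  assumes fin: "finite (carrier G)" and H: "subgroup H G" and X: "MC G \<alpha> w M X"
    and stoch: "stochastic_matrix (lcosets H) Q" and Q: "induced_walk_matrix G H w Q"
  shows "markov_chain M (lcosets H) Q (lumped G H X)"
  unfolding lumped_def
proof (rule markov_chain_strong_lumping[where f = "\<lambda>x. x <# H" and X = X, OF _ fin _ stoch])
  show "markov_chain M (carrier G) (\<lambda>x y. w (inv x \<otimes> y) / sum w (carrier G)) X"
    using X by (simp add: MC_def)
  show "(\<lambda>x. x <# H) \<in> carrier G \<rightarrow> lcosets H" by (auto simp: LCOSETS_def)
  fix x C assume x: "x \<in> carrier G" and "C \<in> lcosets H"
  then obtain g where g: "g \<in> carrier G" "C = g <# H" by (auto simp: LCOSETS_def)
  have HG: "H \<subseteq> carrier G" using H by (rule subgroup.subset)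
  have "(\<Sum>y | y \<in> carrier G \<and> y <# H = C. w (inv x \<otimes> y)) = (\<Sum>h\<in>H. w (inv x \<otimes> (g \<otimes> h)))"
    using g l_coset_fibre[OF H g(1)] l_coset_sum[OF HG g(1)] by simp
  also have "\<dots> = (\<Sum>h\<in>H. w (inv x \<otimes> g \<otimes> h))"
    using x g HG by (intro sum.cong) (auto simp: m_assoc)
  also have "\<dots> = sum w ((inv x \<otimes> g) <# H)"
    using x g by (intro l_coset_sum[OF HG, symmetric]) auto
  finally show "(\<Sum>y | y \<in> carrier G \<and> y <# H = C. w (inv x \<otimes> y) / sum w (carrier G)) =
      Q (x <# H) C"
    unfolding sum_divide_distrib[symmetric] g(2)
    using Q[unfolded induced_walk_matrix_def, rule_format, OF x g(1)] by (simp only:)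
qed

text \<open>The uniform start makes every coset charged at time \<open>0\<close>, so that every entry of the lumped
  matrix is a quotient of joint probabilities of the first two states; left translation by \<open>k\<close>
  preserves both the uniform distribution and the increment \<open>x\<inverse>y\<close>.\<close>

lemma uniform_walk_lumped_matrix_translation_invariant:
  assumes fin: "finite (carrier G)" and H: "subgroup H G"
    and X: "MC G (eta (carrier G)) w M X"
    and Q: "markov_chain M (lcosets H) Q (lumped G H X)"
    and g: "g \<in> carrier G" "g' \<in> carrier G" and k: "k \<in> carrier G"
  shows "Q ((k \<otimes> g) <# H) ((k \<otimes> g') <# H) = Q (g <# H) (g' <# H)"
proof -
  define p where "p = (\<lambda>g. w g / sum w (carrier G))"
  define n where "n = real (card (carrier G))"
  have HG: "H \<subseteq> carrier G" using H by (rule subgroup.subset)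
  have finH: "finite H" using fin HG by (rule finite_subset[rotated])
  have n: "n > 0" unfolding n_def using fin by (simp add: card_gt_0_iff) (use one_closed in blast)
  have cH: "real (card H) > 0"
    using finH subgroup.one_closed[OF H] by (auto simp: card_gt_0_iff)
  have XM: "markov_chain M (carrier G) (\<lambda>x y. p (inv x \<otimes> y)) X"
    and init: "\<And>x. x \<in> carrier G \<Longrightarrow> \<P>(\<omega> in M. X 0 \<omega> = x) = 1 / n"
    using X by (simp_all add: MC_def p_def eta_def n_def)
  interpret prob_space M using XM by (simp add: markov_chain_def)
  have XG: "X t \<omega> \<in> carrier G" if "\<omega> \<in> space M" for t \<omega>
    using XM that measurable_space[of "X t" M "count_space (carrier G)"]
    by (auto simp: markov_chain_def)
  have coset: "finite (a <# H)" "a <# H \<subseteq> carrier G" if "a \<in> carrier G" for a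
    using l_coset_subset_G[OF HG that] fin by (auto intro: finite_subset)
  have in_coset: "x <# H = a <# H \<longleftrightarrow> x \<in> a <# H" if "x \<in> carrier G" "a \<in> carrier G" for x a
    using l_coset_fibre[OF H that(2)] that(1) by blast
  have Q_eq: "Q (a <# H) (b <# H) =
      (\<Sum>h\<in>H. \<Sum>h'\<in>H. 1 / n * p (inv (a \<otimes> h) \<otimes> (b \<otimes> h'))) / (real (card H) / n)"
    if a: "a \<in> carrier G" and b: "b \<in> carrier G" for a b
  proof -
    have "\<P>(\<omega> in M. X 0 \<omega> <# H = a <# H) =
        (\<Sum>x\<in>a <# H. \<P>(\<omega> in M. X 0 \<omega> <# H = a <# H \<and> X 0 \<omega> = x))"
    proof (rule prob_partition)
      fix x assume x: "x \<in> a <# H"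
      then have "X 0 \<omega> <# H = a <# H \<and> X 0 \<omega> = x \<longleftrightarrow> X 0 \<omega> = x" for \<omega>
        using in_coset[OF _ a, of x] coset(2)[OF a] by auto
      then show "{\<omega> \<in> space M. X 0 \<omega> <# H = a <# H \<and> X 0 \<omega> = x} \<in> events"
        using markov_chain_event[OF XM, of x 0] coset(2)[OF a] x by auto
    qed (use coset a in_coset XG in auto)
    also have "\<dots> = (\<Sum>x\<in>a <# H. 1 / n)"
    proof (rule sum.cong[OF refl])
      fix x assume x: "x \<in> a <# H"
      then have "X 0 \<omega> <# H = a <# H \<and> X 0 \<omega> = x \<longleftrightarrow> X 0 \<omega> = x" for \<omega>
        using in_coset[OF _ a, of x] coset(2)[OF a] by auto
      then show "\<P>(\<omega> in M. X 0 \<omega> <# H = a <# H \<and> X 0 \<omega> = x) = 1 / n"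
        using init[of x] coset(2)[OF a] x by auto
    qed
    also have "\<dots> = real (card H) / n"
      using l_card_cosets_equal[OF l_coset_in_lcosets[OF a] HG fin] by simp
    finally have start: "\<P>(\<omega> in M. X 0 \<omega> <# H = a <# H) = real (card H) / n" .
    let ?E = "\<lambda>\<omega>. X 0 \<omega> <# H = a <# H \<and> X 1 \<omega> <# H = b <# H"
    let ?Z = "\<lambda>\<omega>. (X 0 \<omega>, X 1 \<omega>)"
    have E_eq: "?E \<omega> \<and> ?Z \<omega> = (x, y) \<longleftrightarrow> X 0 \<omega> = x \<and> X 1 \<omega> = y"
      if "x \<in> a <# H" "y \<in> b <# H" for x y \<omega>
      using that in_coset[OF _ a, of x] in_coset[OF _ b, of y] coset(2) a b by auto
    have "\<P>(\<omega> in M. ?E \<omega>) = (\<Sum>z\<in>(a <# H) \<times> (b <# H). \<P>(\<omega> in M. ?E \<omega> \<and> ?Z \<omega> = z))"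
    proof (rule prob_partition)
      fix z assume "z \<in> (a <# H) \<times> (b <# H)"
      then obtain x y where z: "z = (x, y)" "x \<in> a <# H" "y \<in> b <# H" by auto
      have "{\<omega> \<in> space M. X 0 \<omega> = x \<and> X 1 \<omega> = y} \<in> events"
        using z coset(2) a b
        by (intro sets.sets_Collect_conj markov_chain_event[OF XM]) auto
      then show "{\<omega> \<in> space M. ?E \<omega> \<and> ?Z \<omega> = z} \<in> events"
        unfolding z(1) E_eq[OF z(2,3)] .
    qed (use coset a b in_coset XG in auto)
    also have "\<dots> = (\<Sum>x\<in>a <# H. \<Sum>y\<in>b <# H. \<P>(\<omega> in M. ?E \<omega> \<and> ?Z \<omega> = (x, y)))"
      by (simp only: sum.cartesian_product split_def prod.collapse)
    also have "\<dots> = (\<Sum>x\<in>a <# H. \<Sum>y\<in>b <# H. 1 / n * p (inv x \<otimes> y))"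
    proof (intro sum.cong refl)
      fix x y assume xy: "x \<in> a <# H" "y \<in> b <# H"
      then have G: "x \<in> carrier G" "y \<in> carrier G" using coset(2) a b by blast+
      show "\<P>(\<omega> in M. ?E \<omega> \<and> ?Z \<omega> = (x, y)) = 1 / n * p (inv x \<otimes> y)"
        unfolding E_eq[OF xy]
        using markov_chain_step[OF XM, of 0 "\<lambda>_. x" y] G init by simp
    qed
    also have "\<dots> = (\<Sum>h\<in>H. \<Sum>h'\<in>H. 1 / n * p (inv (a \<otimes> h) \<otimes> (b \<otimes> h')))"
      unfolding l_coset_sum[OF HG a] l_coset_sum[OF HG b] ..
    finally have joint: "\<P>(\<omega> in M. ?E \<omega>) =
        (\<Sum>h\<in>H. \<Sum>h'\<in>H. 1 / n * p (inv (a \<otimes> h) \<otimes> (b \<otimes> h')))" .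
    have "\<P>(\<omega> in M. ?E \<omega>) = \<P>(\<omega> in M. X 0 \<omega> <# H = a <# H) * Q (a <# H) (b <# H)"
      using markov_chain_step[OF Q, of 0 "\<lambda>_. a <# H" "b <# H"] l_coset_in_lcosets a b
      by (simp add: lumped_def)
    then show ?thesis
      unfolding joint start using n cH by (simp add: field_simps)
  qed
  have "inv (k \<otimes> g \<otimes> h) \<otimes> (k \<otimes> g' \<otimes> h') = inv (g \<otimes> h) \<otimes> (g' \<otimes> h')"
    if "h \<in> H" "h' \<in> H" for h h'
  proof -
    have "h \<in> carrier G" "h' \<in> carrier G" using that HG by auto
    then show ?thesis using g k by (simp add: inv_mult_group m_assoc inv_cancel)
  qed
  then show ?thesis using g k by (simp add: Q_eq)
qed

section \<open>Weights that are constant on double cosets\<close>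

text \<open>Multiplication by \<open>\<eta>\<^sub>H\<close> on the left or right averages over left or right translates by \<open>H\<close>,
  so a bi-invariant weight equals its own sandwich.\<close>

lemma bi_invariant_in_sandwich:
  assumes fin: "finite (carrier G)" and H: "subgroup H G"
    and left: "\<And>h x. h \<in> H \<Longrightarrow> x \<in> carrier G \<Longrightarrow> w (h \<otimes> x) = w x"
    and right: "\<And>h x. h \<in> H \<Longrightarrow> x \<in> carrier G \<Longrightarrow> w (x \<otimes> h) = w x"
  shows "ga_of_weight G w \<in> eta_sandwich G H"
proof -
  let ?a = "ga_of_weight G w"
  have HG: "H \<subseteq> carrier G" using H by (rule subgroup.subset)
  have finH: "finite H" using fin HG by (rule finite_subset[rotated])
  have cH: "card H \<noteq> 0"
    using finH subgroup.one_closed[OF H] by auto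
  have average: "(\<Sum>k\<in>carrier G. eta H k * b k) = c" if "\<And>k. k \<in> H \<Longrightarrow> b k = c"
    for b :: "'a \<Rightarrow> complex" and c
  proof -
    have "(\<Sum>k\<in>carrier G. eta H k * b k) = (\<Sum>k\<in>H. eta H k * b k)"
      by (rule sum.mono_neutral_right) (use fin HG in \<open>auto simp: eta_def\<close>)
    then show ?thesis using that cH by (simp add: eta_def)
  qed
  have "ga_mult G (eta H) ?a = ?a"
  proof
    fix g
    show "ga_mult G (eta H) ?a g = ?a g"
    proof (cases "g \<in> carrier G")
      case True
      have "(\<Sum>k\<in>carrier G. eta H k * ?a (inv k \<otimes> g)) = ?a g"
        using True HG left[OF subgroup.m_inv_closed[OF H]]
        by (intro average) (auto simp: ga_of_weight_def)
      then show ?thesis using True by (simp add: ga_mult_def)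
    qed (simp add: ga_mult_def ga_of_weight_def)
  qed
  moreover have "ga_mult G ?a (eta H) = ?a"
  proof
    fix g
    show "ga_mult G ?a (eta H) g = ?a g"
    proof (cases "g \<in> carrier G")
      case True
      have "(\<Sum>x\<in>carrier G. ?a x * eta H (inv x \<otimes> g)) =
          (\<Sum>k\<in>carrier G. eta H k * ?a (g \<otimes> inv k))"
        by (rule sum.reindex_bij_witness[where i = "\<lambda>k. g \<otimes> inv k" and j = "\<lambda>x. inv x \<otimes> g"])
          (use True in \<open>auto simp: inv_mult_group m_assoc inv_cancel\<close>)
      also have "\<dots> = ?a g"
        using True HG right[OF subgroup.m_inv_closed[OF H]]
        by (intro average) (auto simp: ga_of_weight_def)
      finally show ?thesis using True by (simp add: ga_mult_def)
    qed (simp add: ga_mult_def ga_of_weight_def)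
  qed
  ultimately have "?a = ga_mult G (ga_mult G (eta H) ?a) (eta H)" by simp
  moreover have "?a \<in> group_algebra G" by (simp add: group_algebra_def ga_of_weight_def)
  ultimately show ?thesis unfolding eta_sandwich_def by blast
qed

text \<open>Being constant on each double coset, \<open>w\<close> has sums that depend on cardinalities only, so left
  and right cosets are treated alike.\<close>

lemma bi_invariant_constant_on_cosets:
  assumes H: "subgroup H G"
    and left: "\<And>h x. h \<in> H \<Longrightarrow> x \<in> carrier G \<Longrightarrow> w (h \<otimes> x) = w x"
    and right: "\<And>h x. h \<in> H \<Longrightarrow> x \<in> carrier G \<Longrightarrow> w (x \<otimes> h) = w x"
    and card: "\<And>C. C \<in> \<C> \<Longrightarrow> card C = n"
  shows "constant_on_cosets_in_double_cosets G H \<C> w"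
  unfolding constant_on_cosets_in_double_cosets_def
proof (intro ballI impI)
  fix D C C' assume D: "D \<in> double_cosets G H" and C: "C \<in> \<C>" "C' \<in> \<C>" "C \<subseteq> D" "C' \<subseteq> D"
  obtain x where x: "x \<in> carrier G" "D = H <#> (x <# H)" using D by (auto simp: double_cosets_def)
  have HG: "H \<subseteq> carrier G" using H by (rule subgroup.subset)
  have const: "w y = w x" if "y \<in> D" for y
  proof -
    obtain h h' where "h \<in> H" "h' \<in> H" "y = h \<otimes> (x \<otimes> h')"
      using \<open>y \<in> D\<close> unfolding x(2) set_mult_def l_coset_def by auto
    then show ?thesis using left[of h "x \<otimes> h'"] right[of h' x] x(1) HG by auto
  qed
  have "sum w B = real n * w x" if "B \<in> \<C>" "B \<subseteq> D" for B
  proof -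
    have "sum w B = (\<Sum>y\<in>B. w x)" using that(2) const by (intro sum.cong) auto
    then show ?thesis using card[OF that(1)] by simp
  qed
  then show "sum w C = sum w C'" using C by simp
qed

text \<open>The converse construction: the row of a translation invariant stochastic matrix at the
  coset \<open>H\<close>, spread evenly over the elements of each coset, drives a walk that induces the whole
  matrix. Right invariance of this weight is built in; left invariance is the hypothesis with
  \<open>k \<in> H\<close>, since then \<open>kH = H\<close>.\<close>

lemma coset_row_weight:
  assumes fin: "finite (carrier G)" and H: "subgroup H G"
    and stoch: "stochastic_matrix (lcosets H) Q"
    and Q: "\<And>g g' k. g \<in> carrier G \<Longrightarrow> g' \<in> carrier G \<Longrightarrow> k \<in> carrier G \<Longrightarrow>
      Q (g <# H) (g' <# H) = Q ((k \<otimes> g) <# H) ((k \<otimes> g') <# H)"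
  defines "w \<equiv> (\<lambda>g. Q H (g <# H) / real (card H))"
  shows "weight G w" and "induced_walk_matrix G H w Q"
    and "\<And>h x. h \<in> H \<Longrightarrow> x \<in> carrier G \<Longrightarrow> w (h \<otimes> x) = w x"
    and "\<And>h x. h \<in> H \<Longrightarrow> x \<in> carrier G \<Longrightarrow> w (x \<otimes> h) = w x"
proof -
  have HG: "H \<subseteq> carrier G" using H by (rule subgroup.subset)
  have finH: "finite H" using fin HG by (rule finite_subset[rotated])
  have cH: "card H \<noteq> 0" using finH subgroup.one_closed[OF H] by auto
  have H1: "\<one> <# H = H" using HG by (rule lcos_mult_one)
  have hH: "h <# H = H" if "h \<in> H" for h
    using l_repr_independence[of h \<one> H] that H H1 by simp
  have HL: "H \<in> lcosets H" using l_coset_in_lcosets[of \<one> H] H1 by simp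
  show right: "w (x \<otimes> h) = w x" if "h \<in> H" "x \<in> carrier G" for h x
  proof -
    have "(x \<otimes> h) <# H = x <# (h <# H)" using that HG by (intro lcos_m_assoc[symmetric]) auto
    then show ?thesis using hH[OF that(1)] by (simp add: w_def)
  qed
  show "w (h \<otimes> x) = w x" if "h \<in> H" "x \<in> carrier G" for h x
  proof -
    have "h \<in> carrier G" using that HG by blast
    then have "Q H (x <# H) = Q (h <# H) ((h \<otimes> x) <# H)"
      using Q[of \<one> x h] that H1 by simp
    then show ?thesis using hH[OF that(1)] by (simp add: w_def)
  qed
  have coset: "sum w (x <# H) = Q H (x <# H)" if x: "x \<in> carrier G" for x
  proof -
    have "sum w (x <# H) = (\<Sum>h\<in>H. w x)"
      unfolding l_coset_sum[OF HG x] using right x by (intro sum.cong) auto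
    then show ?thesis using cH by (simp add: w_def)
  qed
  have finC: "finite C" if "C \<in> lcosets H" for C
    using that lcosets_subset_PowG[OF H] fin by (meson PowD finite_subset subsetD)
  have "sum w (carrier G) = (\<Sum>C\<in>lcosets H. sum w C)"
    using sum.Union_disjoint[of "lcosets H" w] lcos_disjoint[OF H] finC lcosets_part_G[OF H]
    by (simp add: pairwise_def disjnt_def)
  also have "\<dots> = (\<Sum>C\<in>lcosets H. Q H C)"
    using coset by (intro sum.cong) (auto simp: LCOSETS_def)
  also have "\<dots> = 1" using stoch HL by (simp add: stochastic_matrix_def)
  finally have total: "sum w (carrier G) = 1" .
  have nonneg: "0 \<le> w g" if "g \<in> carrier G" for g
    using stoch HL l_coset_in_lcosets[OF that] by (simp add: w_def stochastic_matrix_def)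
  moreover have "\<exists>g\<in>carrier G. w g \<noteq> 0"
    using total by (metis sum.neutral zero_neq_one)
  ultimately show "weight G w" by (simp add: weight_def)
  show "induced_walk_matrix G H w Q"
    unfolding induced_walk_matrix_def
  proof (intro ballI)
    fix g g' assume g: "g \<in> carrier G" "g' \<in> carrier G"
    have "Q (g <# H) (g' <# H) = Q ((inv g \<otimes> g) <# H) ((inv g \<otimes> g') <# H)"
      using g by (intro Q) auto
    also have "\<dots> = sum w ((inv g \<otimes> g') <# H)"
      using g H1 coset[of "inv g \<otimes> g'"] by simp
    finally show "Q (g <# H) (g' <# H) = sum w ((inv g \<otimes> g') <# H) / sum w (carrier G)"
      using total by simp
  qed
qed

end

section \<open>Equivalence of the four conditions\<close>

theorem theorem1p11:
  fixes G :: "('a, 'b) monoid_scheme" and H :: "'a set" and Q :: "'a set \<Rightarrow> 'a set \<Rightarrow> real"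
  assumes "group G" and "finite (carrier G)" and "subgroup H G"
    and "stochastic_matrix (lcosets\<^bsub>G\<^esub> H) Q"
  defines "i \<equiv> \<exists>w. weight G w \<and>
      (\<exists>(M :: (nat \<Rightarrow> 'a) measure) X. MC G (eta (carrier G)) w M X \<and> lumps_weakly G H M X \<and>
        markov_chain M (lcosets\<^bsub>G\<^esub> H) Q (lumped G H X))"
    and "ii \<equiv> \<exists>w. weight G w \<and> ga_of_weight G w \<in> eta_sandwich G H \<and>
      induced_walk_matrix G H w Q"
    and "iii \<equiv> \<forall>g\<in>carrier G. \<forall>g'\<in>carrier G. \<forall>k\<in>carrier G.
      Q (g <#\<^bsub>G\<^esub> H) (g' <#\<^bsub>G\<^esub> H) =
      Q ((k \<otimes>\<^bsub>G\<^esub> g) <#\<^bsub>G\<^esub> H) ((k \<otimes>\<^bsub>G\<^esub> g') <#\<^bsub>G\<^esub> H)"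
    and "iv \<equiv> \<exists>w. weight G w \<and>
      constant_on_cosets_in_double_cosets G H (lcosets\<^bsub>G\<^esub> H) w \<and>
      constant_on_cosets_in_double_cosets G H (rcosets\<^bsub>G\<^esub> H) w \<and>
      induced_walk_matrix G H w Q"
  shows "(i \<longleftrightarrow> ii) \<and> (ii \<longleftrightarrow> iii) \<and> (iii \<longleftrightarrow> iv)"
proof -
  interpret group G by fact
  note fin = \<open>finite (carrier G)\<close> and H = \<open>subgroup H G\<close>
    and stoch = \<open>stochastic_matrix (lcosets\<^bsub>G\<^esub> H) Q\<close>
  have i_iii: iii if i
    using that uniform_walk_lumped_matrix_translation_invariant[OF fin H]
    unfolding i_def iii_def by metis
  have ii_iii: iii if ii
    using that induced_walk_matrix_translation_invariant[of H _ Q]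
    unfolding ii_def iii_def by metis
  have iv_iii: iii if iv
    using that induced_walk_matrix_translation_invariant[of H _ Q]
    unfolding iv_def iii_def by metis
  have iii_all: "i \<and> ii \<and> iv" if iii
  proof -
    define w where "w = (\<lambda>g. Q H (g <#\<^bsub>G\<^esub> H) / real (card H))"
    have inv: "Q (g <#\<^bsub>G\<^esub> H) (g' <#\<^bsub>G\<^esub> H) =
        Q ((k \<otimes>\<^bsub>G\<^esub> g) <#\<^bsub>G\<^esub> H) ((k \<otimes>\<^bsub>G\<^esub> g') <#\<^bsub>G\<^esub> H)"
      if "g \<in> carrier G" "g' \<in> carrier G" "k \<in> carrier G" for g g' k
      using \<open>iii\<close> that unfolding iii_def by blast
    have w: "weight G w" "induced_walk_matrix G H w Q"
      and w_left: "\<And>h x. h \<in> H \<Longrightarrow> x \<in> carrier G \<Longrightarrow> w (h \<otimes>\<^bsub>G\<^esub> x) = w x"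
      and w_right: "\<And>h x. h \<in> H \<Longrightarrow> x \<in> carrier G \<Longrightarrow> w (x \<otimes>\<^bsub>G\<^esub> h) = w x"
      unfolding w_def by (rule coset_row_weight[OF fin H stoch inv]; assumption)+
    have HG: "H \<subseteq> carrier G" using H by (rule subgroup.subset)
    have "ga_of_weight G w \<in> eta_sandwich G H"
      by (intro bi_invariant_in_sandwich[OF fin H] w_left w_right)
    then have ii
      unfolding ii_def using w(1,2) by blast
    moreover have iv
    proof -
      have "constant_on_cosets_in_double_cosets G H (lcosets\<^bsub>G\<^esub> H) w"
        by (intro bi_invariant_constant_on_cosets[OF H, where n = "card H"] w_left w_right
            l_card_cosets_equal[OF _ HG fin, symmetric])
      moreover have "constant_on_cosets_in_double_cosets G H (rcosets\<^bsub>G\<^esub> H) w"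
        by (intro bi_invariant_constant_on_cosets[OF H, where n = "card H"] w_left w_right
            card_rcosets_equal[OF _ HG, symmetric])
      ultimately show ?thesis unfolding iv_def using w(1,2) by blast
    qed
    moreover have i
    proof -
      have "carrier G \<noteq> {}" using one_closed by blast
      then have "sum (eta (carrier G)) (carrier G) = (1::real)" using fin by (simp add: eta_def)
      then obtain M :: "(nat \<Rightarrow> 'a) measure" and X where X: "MC G (eta (carrier G)) w M X"
        using MC_exists[OF fin w(1), of "eta (carrier G)"] by (auto simp: eta_def)
      have "markov_chain M (lcosets\<^bsub>G\<^esub> H) Q (lumped G H X)"
        by (rule lumped_walk_markov_chain[OF fin H X stoch w(2)])
      then show ?thesis unfolding i_def lumps_weakly_def using w(1) X by blast
    qed
    ultimately show ?thesis by blast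
  qed
  show ?thesis using i_iii ii_iii iv_iii iii_all by blast
qed

end
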